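(* For $n\geq 1$, $a_n(213;213) = F_n$, where $F_n$ is the $n$-th Fibonacci number.
   Context: Fibonacci numbers: $F_1=F_2=1$, $F_n=F_{n-1}+F_{n-2}$. $\mathcal{S}_n$ is the set of permutations of $[n]=\{1,\dots,n\}$, written in one-line notation $\pi=\pi_1\pi_2\cdots\pi_n$ with $\pi_i=\pi(i)$. A permutation is cyclic if it consists of exactly one $n$-cycle. For a cyclic $\pi$, its standard cycle notation is $C(\pi)=(c_1,c_2,\dots,c_n)$ with $c_1=1$ and $c_i=\pi_{c_{i-1}}$ for $2\le i\le n$. A sequence of distinct integers $w_1\cdots w_m$ contains a pattern $\sigma\in\mathcal{S}_k$ if there are indices $i_1<\dots<i_k$ with $w_{i_1}\cdots w_{i_k}$ in the same relative order as $\sigma_1\cdots\sigma_k$; otherwise it avoids $\sigma$. For $\sigma,\tau\in\mathcal{S}_3$, $\mathcal{A}_n(\sigma;\tau)$ is the set of cyclic permutations $\pi\in\mathcal{S}_n$ whose one-line notation avoids $\sigma$ and whose cycle notation $C(\pi)$ (as the sequence $c_1c_2\cdots c_n$) avoids $\tau$; $a_n(\sigma;\tau)=|\mathcal{A}_n(\sigma;\tau)|$. *)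

theory Defs
  imports "HOL-Combinatorics.Orbits" "HOL-Number_Theory.Fib"
begin

text \<open>
  A permutation of \<open>[n]\<close> is a function \<open>\<pi> :: nat \<Rightarrow> nat\<close> with \<open>\<pi> permutes {1..n}\<close>; such a
  function is the identity outside \<open>{1..n}\<close>, so each permutation is represented exactly once.
  Words and patterns are lists (indexed from 0), so the pattern 213 is \<open>[2, 1, 3]\<close>.
\<close>

definition one_line :: "nat \<Rightarrow> (nat \<Rightarrow> nat) \<Rightarrow> nat list" where
  "one_line n \<pi> = map \<pi> [1..<Suc n]"

text \<open>The 0-based entry \<open>i\<close> is \<open>(\<pi> ^^ i) 1\<close>, i.e. \<open>c\<^sub>1 = 1\<close> and each further entry is the image
  of the preceding one under \<open>\<pi>\<close>; this is the standard cycle notation when \<open>\<pi>\<close> is cyclic.\<close>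

definition cycle_notation :: "nat \<Rightarrow> (nat \<Rightarrow> nat) \<Rightarrow> nat list" where
  "cycle_notation n \<pi> = map (\<lambda>i. (\<pi> ^^ i) 1) [0..<n]"

lemma cycle_notation_nth_0: "n > 0 \<Longrightarrow> cycle_notation n \<pi> ! 0 = 1"
  by (simp add: cycle_notation_def)

lemma cycle_notation_nth_Suc:
  "Suc i < n \<Longrightarrow> cycle_notation n \<pi> ! Suc i = \<pi> (cycle_notation n \<pi> ! i)"
  by (simp add: cycle_notation_def)

definition contains_pattern :: "nat list \<Rightarrow> nat list \<Rightarrow> bool" where
  "contains_pattern w \<sigma> \<longleftrightarrow>
     (\<exists>f :: nat \<Rightarrow> nat.
        strict_mono_on {..<length \<sigma>} f \<and> (\<forall>a<length \<sigma>. f a < length w) \<and>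
        (\<forall>a<length \<sigma>. \<forall>b<length \<sigma>. w ! f a < w ! f b \<longleftrightarrow> \<sigma> ! a < \<sigma> ! b))"

definition avoids :: "nat list \<Rightarrow> nat list \<Rightarrow> bool" where
  "avoids w \<sigma> \<longleftrightarrow> \<not> contains_pattern w \<sigma>"

definition cyclic_avoiders :: "nat \<Rightarrow> nat list \<Rightarrow> nat list \<Rightarrow> (nat \<Rightarrow> nat) set" where
  "cyclic_avoiders n \<sigma> \<tau> =
     {\<pi>. \<pi> permutes {1..n} \<and> cyclic_on \<pi> {1..n} \<and>
         avoids (one_line n \<pi>) \<sigma> \<and> avoids (cycle_notation n \<pi>) \<tau>}"

definition num_cyclic_avoiders :: "nat \<Rightarrow> nat list \<Rightarrow> nat list \<Rightarrow> nat" where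
  "num_cyclic_avoiders n \<sigma> \<tau> = card (cyclic_avoiders n \<sigma> \<tau>)"

lemma finite_cyclic_avoiders: "finite (cyclic_avoiders n \<sigma> \<tau>)"
  by (rule finite_subset[OF _ finite_permutations[of "{1..n}"]])
     (auto simp: cyclic_avoiders_def)

end

theory Submission
  imports Defs "HOL-Combinatorics.Cycles"
begin

text \<open>
  A cyclic permutation of an interval \<open>{a..b}\<close> is encoded by its cycle notation, a list \<open>c\<close> starting
  with \<open>a\<close>; the graph of the permutation is recovered by pairing \<open>c\<close> with its rotation. If \<open>c\<close> and
  the one-line notation both avoid 213, then the second entry of \<open>c\<close> is \<open>a + 1\<close>, which forces \<open>c\<close> to
  be increasing, or it is \<open>b\<close>. In the latter case, either the third entry is \<open>a + 1\<close>, and deleting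
  \<open>a, b\<close> leaves an arbitrary avoider on \<open>{a+1..b-1}\<close>; or the last entry is \<open>a + 1\<close>, and moving it
  to the front in place of \<open>a\<close> gives an avoider on \<open>{a+1..b}\<close> that again has second entry \<open>b\<close>.
  Since the increasing cycle is the only avoider whose second entry is not the maximum, the counts
  satisfy the Fibonacci recurrence. Working on arbitrary intervals avoids relabelling after deletions.
\<close>

section \<open>213-avoidance of words and of point sets\<close>

fun avoids_213 :: "nat list \<Rightarrow> bool" where
  "avoids_213 [] \<longleftrightarrow> True"
| "avoids_213 (x # xs) \<longleftrightarrow> sorted_wrt (\<lambda>u v. \<not> (u < x \<and> x < v)) xs \<and> avoids_213 xs"

text \<open>Points are pairs (position, value). Working with a set of points instead of a word
  allows points to be added or moved without renumbering positions.\<close>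

definition graph_avoids_213 :: "(nat \<times> nat) set \<Rightarrow> bool" where
  "graph_avoids_213 G \<longleftrightarrow>
     (\<forall>x1 y1 x2 y2 x3 y3. (x1, y1) \<in> G \<longrightarrow> (x2, y2) \<in> G \<longrightarrow> (x3, y3) \<in> G \<longrightarrow>
        x1 < x2 \<longrightarrow> x2 < x3 \<longrightarrow> y2 < y1 \<longrightarrow> \<not> y1 < y3)"

text \<open>For a list with distinct entries, this is the graph of the cyclic permutation with cycle notation \<open>c\<close>.\<close>
definition cycle_graph :: "nat list \<Rightarrow> (nat \<times> nat) set" where
  "cycle_graph c = set (zip c (rotate1 c))"

lemma graph_avoids_213D:
  assumes "graph_avoids_213 G" "(x1, y1) \<in> G" "(x2, y2) \<in> G" "(x3, y3) \<in> G"
    "x1 < x2" "x2 < x3" "y2 < y1" "y1 < y3"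
  shows False
  using assms unfolding graph_avoids_213_def by blast

lemma avoids_213_appendD: "avoids_213 (us @ vs) \<Longrightarrow> avoids_213 vs"
  by (induction us) auto

lemma avoids_213D:
  assumes "avoids_213 (us @ x # vs @ y # ws)" "z \<in> set ws" "y < x" "x < z"
  shows False
  using avoids_213_appendD[OF assms(1)] assms(2-) by (auto simp: sorted_wrt_append)

text \<open>A 213 ends in its largest entry, so a final minimum lies in none. In the next two
  lemmas: a 213 begins with its middle value, so a first entry that is extremal lies in
  none.\<close>

lemma avoids_213_snoc_min:
  assumes "\<forall>x \<in> set xs. m \<le> x"
  shows "avoids_213 (xs @ [m]) \<longleftrightarrow> avoids_213 xs"
  using assms by (induction xs) (auto simp: sorted_wrt_append)

lemma avoids_213_Cons_min:
  assumes "\<forall>x \<in> set xs. m \<le> x"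
  shows "avoids_213 (m # xs) \<longleftrightarrow> avoids_213 xs"
  using assms by (auto simp: sorted_wrt_iff_nth_less not_less)

lemma avoids_213_Cons_max:
  assumes "\<forall>x \<in> set xs. x \<le> m"
  shows "avoids_213 (m # xs) \<longleftrightarrow> avoids_213 xs"
  using assms by (auto simp: sorted_wrt_iff_nth_less not_less)

lemma avoids_213_sorted: "sorted xs \<Longrightarrow> avoids_213 xs"
  by (induction xs) (simp_all add: avoids_213_Cons_min del: avoids_213.simps(2))

text \<open>Any inversion in \<open>xs\<close> would form a 213 with the final
  \<open>m\<close>.\<close>

lemma sorted_if_avoids_213_snoc_max:
  assumes "avoids_213 (xs @ [m])" "\<forall>x \<in> set xs. x < m"
  shows "sorted xs"
  using assms by (induction xs) (auto simp: sorted_wrt_append not_less)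

section \<open>The graph of a cycle\<close>

lemma cycle_graph_next: "(x, y) \<in> cycle_graph (us @ x # y # vs)"
proof -
  have "(us @ x # y # vs) ! length us = x" by (simp add: nth_append)
  moreover have "rotate1 (us @ x # y # vs) ! length us = y"
    by (cases us) (auto simp: nth_append)
  ultimately show ?thesis
    unfolding cycle_graph_def in_set_zip by (intro exI[of _ "length us"]) auto
qed

lemma cycle_graph_last: "(x, z) \<in> cycle_graph (z # us @ [x])"
proof -
  have "(z # us @ [x]) ! Suc (length us) = x" by (simp add: nth_append)
  moreover have "rotate1 (z # us @ [x]) ! Suc (length us) = z"
    by (auto simp: nth_append)
  ultimately show ?thesis
    unfolding cycle_graph_def in_set_zip by (intro exI[of _ "Suc (length us)"]) auto
qed

lemma cycle_graph_inj:
  assumes "distinct c" "(x, z) \<in> cycle_graph c" "(y, z) \<in> cycle_graph c"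
  shows "x = y"
proof -
  have "distinct (map snd (zip c (rotate1 c)))"
    using assms(1) by simp
  then have "inj_on snd (cycle_graph c)"
    unfolding cycle_graph_def by (simp only: distinct_map)
  then show ?thesis using inj_onD[OF _ _ assms(2,3)] by fastforce
qed

lemma cycle_graph_ex:
  assumes "x \<in> set c"
  obtains y where "y \<in> set c" "(x, y) \<in> cycle_graph c"
proof -
  obtain i where "i < length c" "c ! i = x" using assms by (metis in_set_conv_nth)
  then have "(x, rotate1 c ! i) \<in> cycle_graph c" "rotate1 c ! i \<in> set c"
    unfolding cycle_graph_def in_set_zip using nth_mem[of i "rotate1 c"] by auto
  then show ?thesis using that by blast
qed

text \<open>If \<open>x\<close> is the last entry, the cycle closes at \<open>a < j\<close>.
  Otherwise the entry after \<open>x\<close> cannot exceed \<open>j\<close>, since it would complete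
  \<open>j\<close>, \<open>x\<close> to a 213. This supplies the small values needed to build a 213
  in the graph.\<close>

lemma successor_of_smaller:
  assumes "avoids_213 (a # us @ j # vs)" "x \<in> set vs" "x < j" "a < j" "j \<notin> set vs"
  obtains y where "(x, y) \<in> cycle_graph (a # us @ j # vs)" "y < j"
proof -
  obtain ps qs where vs: "vs = ps @ x # qs" using assms(2) by (meson split_list)
  show ?thesis
  proof (cases qs)
    case Nil
    then show ?thesis
      using that[of a] cycle_graph_last[of x a "us @ j # ps"] vs assms(4) by simp
  next
    case (Cons y rs)
    have "\<not> j < y" using avoids_213D[of "a # us" j ps x qs y] assms(1,3) vs Cons by auto
    moreover have "y \<noteq> j" using assms(5) vs Cons by auto
    ultimately show ?thesis
      using that[of y] cycle_graph_next[of x y "a # us @ j # ps" rs] vs Cons by simp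
  qed
qed

section \<open>Avoiding cycles on an interval: second and third entries\<close>

definition avoiding_cycles :: "nat \<Rightarrow> nat \<Rightarrow> nat list set" where
  "avoiding_cycles a b =
     {c. distinct c \<and> set c = {a..b} \<and> hd c = a \<and> avoids_213 c \<and> graph_avoids_213 (cycle_graph c)}"

text \<open>Otherwise the one-line notation has a 213 at the positions \<open>a < a + 1 < j\<close>: the image of \<open>a\<close>
  is \<open>j\<close>, that of \<open>j\<close> is larger than \<open>j\<close>, and \<open>a + 1\<close>, coming after \<open>j\<close> in the cycle, has an
  image below \<open>j\<close>.\<close>
lemma second_entry:
  assumes "a # j # r \<in> avoiding_cycles a b"
  shows "j = Suc a \<or> j = b"
proof (rule ccontr)
  let ?c = "a # j # r"
  assume neg: "\<not> (j = Suc a \<or> j = b)"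
  from assms have d: "distinct ?c" "set ?c = {a..b}" "avoids_213 ?c" "graph_avoids_213 (cycle_graph ?c)"
    by (auto simp: avoiding_cycles_def)
  have "j \<in> {a..b}" "j \<noteq> a" using d by auto
  then have j: "Suc a < j" "j < b" using neg by auto
  then have "Suc a \<in> set ?c" "b \<in> set ?c" unfolding d(2) by auto
  then have mem: "Suc a \<in> set r" "b \<in> set r" using j by auto
  obtain y where y: "(Suc a, y) \<in> cycle_graph ?c" "y < j"
    using successor_of_smaller[of a "[]" j r "Suc a"] d j mem by auto
  obtain z r' where r: "r = z # r'" using mem(1) by (cases r) auto
  \<comment> \<open>If \<open>z < j\<close>, then \<open>b\<close> comes after \<open>z\<close>, and
    \<open>j\<close>, \<open>z\<close>, \<open>b\<close> is a 213 in the cycle notation.\<close>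
  have "\<not> z < j"
    using avoids_213D[of "[a]" j "[]" z r' b] d(3) r mem j by auto
  moreover have "z \<noteq> j" using d(1) r by auto
  ultimately have "j < z" by simp
  moreover have "(j, z) \<in> cycle_graph ?c" using cycle_graph_next[of j z "[a]" r'] r by simp
  moreover have "(a, j) \<in> cycle_graph ?c" using cycle_graph_next[of a j "[]" r] by simp
  ultimately show False using graph_avoids_213D[OF d(4), of a j "Suc a" y j z] y j by simp
qed

text \<open>The preimage \<open>p\<close> of \<open>a\<close> must be \<open>b\<close>, as otherwise the positions \<open>a < p < b\<close> carry a 213.
  So the cycle ends in its maximum, and any descent before it would complete to a 213.\<close>
lemma increasing_cycle:
  assumes "a # Suc a # r \<in> avoiding_cycles a b"
  shows "a # Suc a # r = [a..<Suc b]"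
proof -
  let ?c = "a # Suc a # r"
  from assms have d: "distinct ?c" "set ?c = {a..b}" "avoids_213 ?c" "graph_avoids_213 (cycle_graph ?c)"
    by (auto simp: avoiding_cycles_def)
  define us where "us = butlast (Suc a # r)"
  define p where "p = last ?c"
  have c: "?c = a # us @ [p]"
    unfolding us_def p_def by simp
  have pa: "(p, a) \<in> cycle_graph ?c" unfolding c by (rule cycle_graph_last)
  have ab: "Suc a \<le> b" using d(2) by force
  have p: "p \<in> {a..b}" "p \<noteq> a" using d(1) unfolding d(2)[symmetric] c by auto
  have asa: "(a, Suc a) \<in> cycle_graph ?c" using cycle_graph_next[of a "Suc a" "[]" r] by simp
  have "p = b"
  proof (rule ccontr)
    assume "p \<noteq> b"
    have "b \<in> set ?c" unfolding d(2) using ab by simp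
    then obtain q where q: "q \<in> set ?c" "(b, q) \<in> cycle_graph ?c" by (rule cycle_graph_ex)
    \<comment> \<open>\<open>a\<close> and \<open>Suc a\<close> are the images of \<open>p\<close>
      and \<open>a\<close>, both different from \<open>b\<close>, so injectivity leaves
      \<open>q\<close> above \<open>Suc a\<close>.\<close>
    have "q \<noteq> a" using cycle_graph_inj[OF d(1) pa] q(2) \<open>p \<noteq> b\<close> by blast
    moreover have "q \<noteq> Suc a" using cycle_graph_inj[OF d(1) asa] q(2) ab by fastforce
    ultimately have "Suc a < q" using q(1) unfolding d(2) by auto
    then show False
      using graph_avoids_213D[OF d(4) asa pa q(2)] p \<open>p \<noteq> b\<close> by auto
  qed
  have lt: "\<forall>x \<in> set (a # us). x < b"
  proof
    fix x assume "x \<in> set (a # us)"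
    then have "x \<in> set ?c" "x \<noteq> p" using d(1) unfolding c by auto
    then show "x < b" unfolding d(2) \<open>p = b\<close> by auto
  qed
  have us: "sorted (a # us)"
    using sorted_if_avoids_213_snoc_max[OF _ lt] d(3) unfolding c \<open>p = b\<close> by simp
  have "sorted ((a # us) @ [b])"
    unfolding sorted_append using us lt by (auto intro: less_imp_le simp del: sorted_wrt.simps(2) simp: sorted_wrt1)
  then have "sorted ?c" unfolding c \<open>p = b\<close> by simp
  moreover have "set [a..<Suc b] = set ?c" unfolding d(2) by auto
  ultimately show ?thesis
    using d(1) by (intro sorted_distinct_set_unique) (simp_all only: sorted_upt distinct_upt)
qed

text \<open>If the preimage \<open>p\<close> of \<open>a\<close> is not \<open>a + 1\<close>, the positions \<open>a + 1 < p < b\<close> carry a 213 with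
  last value \<open>k\<close>.\<close>
lemma third_entry:
  assumes "a # b # k # r \<in> avoiding_cycles a b" "k \<noteq> Suc a"
  shows "last (k # r) = Suc a"
proof -
  let ?c = "a # b # k # r"
  from assms have d: "distinct ?c" "set ?c = {a..b}" "avoids_213 ?c" "graph_avoids_213 (cycle_graph ?c)"
    by (auto simp: avoiding_cycles_def)
  have "k \<in> {a..b}" unfolding d(2)[symmetric] by simp
  then have k: "Suc a < k" "k < b" using d(1) assms(2) by auto
  then have "Suc a \<in> set ?c" unfolding d(2) by simp
  then have "Suc a \<in> set r" using k by auto
  then obtain s where s: "(Suc a, s) \<in> cycle_graph ?c" "s < k"
    using successor_of_smaller[of a "[b]" k r "Suc a"] d k by auto
  have bk: "(b, k) \<in> cycle_graph ?c" using cycle_graph_next[of b k "[a]" r] by simp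
  define p where "p = last (k # r)"
  have c: "?c = a # (b # butlast (k # r)) @ [p]"
    unfolding p_def by simp
  have pa: "(p, a) \<in> cycle_graph ?c" unfolding c by (rule cycle_graph_last)
  have p: "p \<in> {a..b}" "p \<noteq> a" "p \<noteq> b" using d(1) unfolding d(2)[symmetric] c by auto
  have sin: "s \<in> set ?c" using s(1) unfolding cycle_graph_def by (metis set_zip_rightD set_rotate1)
  have "p = Suc a"
  proof (rule ccontr)
    assume "p \<noteq> Suc a"
    \<comment> \<open>Only \<open>p\<close> maps to \<open>a\<close>, so \<open>a < s < k\<close>:
      the values \<open>s\<close>, \<open>a\<close>, \<open>k\<close> at the positions
      \<open>Suc a\<close>, \<open>p\<close>, \<open>b\<close> are the 213.\<close>
    then have "s \<noteq> a" using cycle_graph_inj[OF d(1) pa] s(1) by blast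
    then have "a < s" using sin unfolding d(2) by auto
    then show False
      using graph_avoids_213D[OF d(4) s(1) pa bk] p \<open>p \<noteq> Suc a\<close> s(2) by auto
  qed
  then show ?thesis unfolding p_def .
qed

text \<open>Every \<open>x < b\<close> goes to \<open>x + 1\<close>, so the only descent in one-line
  notation ends at the last position \<open>b\<close>, where no larger value can follow.\<close>

lemma upt_avoiding:
  assumes "a \<le> b"
  shows "[a..<Suc b] \<in> avoiding_cycles a b"
proof -
  have g: "y = (if x = b then a else Suc x) \<and> x \<le> b"
    if xy: "(x, y) \<in> cycle_graph [a..<Suc b]" for x y
  proof -
    obtain i where i: "i < Suc b - a" "x = [a..<Suc b] ! i" "y = rotate1 [a..<Suc b] ! i"
      using xy unfolding cycle_graph_def in_set_zip by (auto simp del: upt_Suc)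
    have x: "x = a + i" using i by (simp del: upt_Suc)
    have y: "y = [a..<Suc b] ! (Suc i mod (Suc b - a))"
      using i by (simp add: nth_rotate1 del: upt_Suc)
    show ?thesis
    proof (cases "x = b")
      case True
      then have "Suc i = Suc b - a" using x by simp
      then show ?thesis using y True assms by (simp del: upt_Suc)
    next
      case False
      then have "Suc i < Suc b - a" using x i by simp
      then show ?thesis using y x False by (simp del: upt_Suc)
    qed
  qed
  have "graph_avoids_213 (cycle_graph [a..<Suc b])"
    unfolding graph_avoids_213_def
  proof (intro allI impI)
    fix x1 y1 x2 y2 x3 y3
    assume p: "(x1, y1) \<in> cycle_graph [a..<Suc b]" "(x2, y2) \<in> cycle_graph [a..<Suc b]"
        "(x3, y3) \<in> cycle_graph [a..<Suc b]"
      and less: "x1 < x2" "x2 < x3" "y2 < y1"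
    have "y1 = Suc x1" "y2 = Suc x2" using g[OF p(1)] g[OF p(2)] g[OF p(3)] less by simp_all
    then show "\<not> y1 < y3" using less by simp
  qed
  moreover have "set [a..<Suc b] = {a..b}" "hd [a..<Suc b] = a"
    using assms by (auto simp: hd_upt simp del: upt_Suc)
  ultimately show ?thesis
    by (simp add: avoiding_cycles_def avoids_213_sorted del: upt_Suc)
qed

section \<open>Inserting extreme points into a graph\<close>

text \<open>A leftmost point can only be the 2 of a 213, which requires values both below and above
  its own.\<close>

lemma graph_avoids_213_insert_min:
  assumes minx: "\<And>x y. (x, y) \<in> G \<Longrightarrow> X \<le> x"
    and ext: "(\<forall>(x, y) \<in> G. y \<le> Y) \<or> (\<forall>(x, y) \<in> G. Y \<le> y)"
  shows "graph_avoids_213 (insert (X, Y) G) \<longleftrightarrow> graph_avoids_213 G"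
proof
  assume G: "graph_avoids_213 G"
  show "graph_avoids_213 (insert (X, Y) G)"
    unfolding graph_avoids_213_def
  proof (intro allI impI notI)
    fix x1 y1 x2 y2 x3 y3
    assume p: "(x1, y1) \<in> insert (X, Y) G" "(x2, y2) \<in> insert (X, Y) G"
        "(x3, y3) \<in> insert (X, Y) G"
      and less: "x1 < x2" "x2 < x3" "y2 < y1" "y1 < y3"
    have "X \<le> x1" using p(1) minx by auto
    then have p23: "(x2, y2) \<in> G" "(x3, y3) \<in> G" using p less by auto
    show False
    proof (cases "(x1, y1) \<in> G")
      case True
      then show False using graph_avoids_213D[OF G _ p23 less] by blast
    next
      case False
      then have "y1 = Y" using p(1) by simp
      moreover have "y3 \<le> Y \<or> Y \<le> y2" using ext p23 by blast
      ultimately show False using less by linarith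
    qed
  qed
qed (simp add: graph_avoids_213_def)

text \<open>A rightmost point can only be the 3 of a 213, and there are no two distinct values below
  \<open>Suc a\<close> when all are at least \<open>a\<close>.\<close>

lemma graph_avoids_213_insert_max:
  assumes maxx: "\<And>x y. (x, y) \<in> G \<Longrightarrow> x \<le> X" and ge: "\<And>x y. (x, y) \<in> G \<Longrightarrow> a \<le> y"
  shows "graph_avoids_213 (insert (X, Suc a) G) \<longleftrightarrow> graph_avoids_213 G"
proof
  assume G: "graph_avoids_213 G"
  show "graph_avoids_213 (insert (X, Suc a) G)"
    unfolding graph_avoids_213_def
  proof (intro allI impI notI)
    fix x1 y1 x2 y2 x3 y3
    assume p: "(x1, y1) \<in> insert (X, Suc a) G" "(x2, y2) \<in> insert (X, Suc a) G"
        "(x3, y3) \<in> insert (X, Suc a) G"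
      and less: "x1 < x2" "x2 < x3" "y2 < y1" "y1 < y3"
    have "x3 \<le> X" using p(3) maxx by auto
    then have p12: "(x1, y1) \<in> G" "(x2, y2) \<in> G" using p less by auto
    have "y3 \<noteq> Suc a" using ge[OF p12(2)] less by linarith
    then have "(x3, y3) \<in> G" using p(3) by simp
    then show False using graph_avoids_213D[OF G p12 _ less] by blast
  qed
qed (simp add: graph_avoids_213_def)

text \<open>The condition on the right does not depend on \<open>Y\<close>: a lowest point may be moved vertically.\<close>
lemma graph_avoids_213_insert_bot:
  assumes bot: "\<And>x y. (x, y) \<in> G \<Longrightarrow> Y < y"
  shows "graph_avoids_213 (insert (X, Y) G) \<longleftrightarrow> graph_avoids_213 G \<and>
    (\<forall>(x1, y1) \<in> G. \<forall>(x3, y3) \<in> G. x1 < X \<longrightarrow> X < x3 \<longrightarrow> \<not> y1 < y3)"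
  (is "?L \<longleftrightarrow> ?R")
proof
  assume L: ?L
  have "graph_avoids_213 G" using L by (simp add: graph_avoids_213_def)
  moreover have "\<not> y1 < y3"
    if "(x1, y1) \<in> G" "(x3, y3) \<in> G" "x1 < X" "X < x3" for x1 y1 x3 y3
    using graph_avoids_213D[OF L, of x1 y1 X Y x3 y3] bot that by blast
  ultimately show ?R by blast
next
  assume R: ?R
  then have G: "graph_avoids_213 G" ..
  show ?L
    unfolding graph_avoids_213_def
  proof (intro allI impI notI)
    fix x1 y1 x2 y2 x3 y3
    assume p: "(x1, y1) \<in> insert (X, Y) G" "(x2, y2) \<in> insert (X, Y) G"
        "(x3, y3) \<in> insert (X, Y) G"
      and less: "x1 < x2" "x2 < x3" "y2 < y1" "y1 < y3"
    \<comment> \<open>The 2 and the 3 of a 213 lie strictly above its 1, so neither is the lowest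
      point.\<close>
    have "Y \<le> y2" using p(2) bot by fastforce
    then have p13: "(x1, y1) \<in> G" "(x3, y3) \<in> G" using p less by auto
    show False
    proof (cases "(x2, y2) \<in> G")
      case True
      then show False using graph_avoids_213D[OF G p13(1) _ p13(2) less] by blast
    next
      case False
      then have "x2 = X" using p(2) by simp
      then show False using R p13 less by blast
    qed
  qed
qed

section \<open>The two reductions to smaller intervals\<close>

text \<open>With \<open>l\<close> the last entry, deleting \<open>a\<close> and \<open>b\<close>
  removes the points \<open>(a, b)\<close> and \<open>(b, Suc a)\<close> and raises
  \<open>(l, a)\<close> to \<open>(l, Suc a)\<close>. The first point is leftmost and highest, the
  second is rightmost and at most one above the minimum, and the third stays lowest.\<close>

lemma avoiding_cycles_Cons2_iff:
  assumes "Suc a < b"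
  shows "a # b # Suc a # r \<in> avoiding_cycles a b \<longleftrightarrow> Suc a # r \<in> avoiding_cycles (Suc a) (b - 1)"
    (is "a # b # ?c \<in> _ \<longleftrightarrow> _")
proof -
  have sets: "distinct (a # b # ?c) \<and> set (a # b # ?c) = {a..b} \<longleftrightarrow>
      distinct ?c \<and> set ?c = {Suc a..b - 1}" (is "?A \<longleftrightarrow> ?B")
  proof
    assume A: ?A
    then have "set ?c = {a..b} - {a, b}" by auto
    also have "\<dots> = {Suc a..b - 1}" by auto
    finally show ?B using A by simp
  next
    assume B: ?B
    then have "set (a # b # ?c) = insert a (insert b {Suc a..b - 1})" by simp
    also have "\<dots> = {a..b}" using assms by auto
    finally show ?A using B assms by simp
  qed
  have "avoids_213 (a # b # ?c) \<and> graph_avoids_213 (cycle_graph (a # b # ?c)) \<longleftrightarrow>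
      avoids_213 ?c \<and> graph_avoids_213 (cycle_graph ?c)" if B: ?B
  proof -
    have bd: "\<forall>x \<in> set ?c. Suc a \<le> x \<and> x < b" using B assms by auto
    then have "\<forall>x \<in> set ?c. x \<le> b" "\<forall>x \<in> set (b # ?c). a \<le> x" using assms by auto
    then have av: "avoids_213 (a # b # ?c) \<longleftrightarrow> avoids_213 ?c"
      by (simp only: avoids_213_Cons_min avoids_213_Cons_max)
    \<comment> \<open>\<open>Q\<close> is the part common to both graphs: all points except those at
      the positions \<open>a\<close>, \<open>b\<close> and \<open>l\<close>.\<close>
    define q where "q = butlast ?c"
    define l where "l = last ?c"
    define Q where "Q = set (zip q r)"
    have c: "?c = q @ [l]" unfolding q_def l_def by simp
    have len: "length q = length r" unfolding q_def by simp
    have zip: "zip ?c (r @ [y]) = zip q r @ [(l, y)]" for y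
      unfolding c using len by simp
    have g1: "cycle_graph ?c = insert (l, Suc a) Q"
      unfolding cycle_graph_def rotate1.simps zip Q_def by simp
    have "cycle_graph (a # b # ?c) = insert (a, b) (insert (b, Suc a) (set (zip ?c (r @ [a]))))"
      unfolding cycle_graph_def by simp
    then have g2: "cycle_graph (a # b # ?c) = insert (a, b) (insert (b, Suc a) (insert (l, a) Q))"
      unfolding zip Q_def by simp
    have l: "Suc a \<le> l" "l < b" using bd c by auto
    have Q: "Suc a \<le> x \<and> x < b \<and> Suc a < y \<and> y < b" if "(x, y) \<in> Q" for x y
    proof -
      have "x \<in> set ?c" "y \<in> set r"
        using that c unfolding Q_def by (auto dest: set_zip_leftD set_zip_rightD)
      \<comment> \<open>This makes the heights in \<open>Q\<close> exceed \<open>Suc a\<close>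
        strictly, so \<open>(l, Suc a)\<close> is still a lowest point.\<close>
      moreover have "Suc a \<notin> set r" using B by simp
      ultimately show ?thesis using bd by (metis le_neq_implies_less list.set_intros(2))
    qed
    have "graph_avoids_213 (cycle_graph (a # b # ?c)) \<longleftrightarrow> graph_avoids_213 (insert (l, a) Q)"
      unfolding g2 using l Q assms
      by (subst graph_avoids_213_insert_min, fastforce, fastforce,
        subst graph_avoids_213_insert_max) fastforce+
    also have "\<dots> \<longleftrightarrow> graph_avoids_213 (insert (l, Suc a) Q)"
      using Q by (subst (1 2) graph_avoids_213_insert_bot) fastforce+
    finally show ?thesis using av g1 by simp
  qed
  then show ?thesis unfolding avoiding_cycles_def using sets by auto
qed

text \<open>Both graphs contain \<open>Q\<close>; the left one adds \<open>(a, b)\<close> and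
  \<open>(Suc a, a)\<close>, the right one \<open>(Suc a, b)\<close>. Each of these is leftmost with
  extreme height when inserted, so both conditions reduce to \<open>Q\<close>.\<close>

lemma avoiding_cycles_rotate_iff:
  assumes "Suc a < b"
  shows "a # b # r @ [Suc a] \<in> avoiding_cycles a b \<longleftrightarrow> Suc a # b # r \<in> avoiding_cycles (Suc a) b"
    (is "?c \<in> _ \<longleftrightarrow> ?c' \<in> _")
proof -
  have "{a..b} = insert a {Suc a..b}" using assms by auto
  moreover have "a \<notin> {Suc a..b}" by simp
  ultimately have "distinct (a # xs) \<and> set (a # xs) = {a..b} \<longleftrightarrow> distinct xs \<and> set xs = {Suc a..b}" for xs
    unfolding distinct.simps list.set using insert_ident by metis
  from this[of "b # r @ [Suc a]"]
  have sets: "distinct ?c \<and> set ?c = {a..b} \<longleftrightarrow> distinct ?c' \<and> set ?c' = {Suc a..b}" (is "?A \<longleftrightarrow> ?B")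
    by (simp add: insert_commute conj_ac eq_commute[of b "Suc a"])
  have "avoids_213 ?c \<and> graph_avoids_213 (cycle_graph ?c) \<longleftrightarrow>
      avoids_213 ?c' \<and> graph_avoids_213 (cycle_graph ?c')" if B: ?B
  proof -
    have bd: "\<forall>x \<in> set ?c'. Suc a \<le> x \<and> x \<le> b" using B by auto
    have "avoids_213 ?c \<longleftrightarrow> avoids_213 ((b # r) @ [Suc a])"
      using bd by (subst avoids_213_Cons_min) auto
    also have "\<dots> \<longleftrightarrow> avoids_213 (b # r)"
      using bd by (subst avoids_213_snoc_min) auto
    also have "\<dots> \<longleftrightarrow> avoids_213 ?c'"
      using bd by (subst (2) avoids_213_Cons_min) auto
    finally have av: "avoids_213 ?c \<longleftrightarrow> avoids_213 ?c'" .
    define Q where "Q = set (zip (b # r) (r @ [Suc a]))"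
    have g1: "cycle_graph ?c' = insert (Suc a, b) Q"
      unfolding cycle_graph_def Q_def by simp
    have "zip ?c (rotate1 ?c) = (a, b) # zip ((b # r) @ [Suc a]) ((r @ [Suc a]) @ [a])"
      by simp
    also have "\<dots> = (a, b) # zip (b # r) (r @ [Suc a]) @ [(Suc a, a)]"
      by (subst zip_append) simp_all
    finally have g2: "cycle_graph ?c = insert (a, b) (insert (Suc a, a) Q)"
      unfolding cycle_graph_def Q_def by (simp del: zip_Cons_Cons)
    have Q: "Suc a \<le> x \<and> x \<le> b \<and> Suc a \<le> y \<and> y \<le> b" if "(x, y) \<in> Q" for x y
    proof -
      have "x \<in> set ?c'" "y \<in> set ?c'"
        using set_zip_leftD[OF that[unfolded Q_def]] set_zip_rightD[OF that[unfolded Q_def]] by auto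
      then show ?thesis using bd by blast
    qed
    have "graph_avoids_213 (cycle_graph ?c) \<longleftrightarrow> graph_avoids_213 (insert (Suc a, a) Q)"
      unfolding g2 using Q assms by (intro graph_avoids_213_insert_min) fastforce+
    also have "\<dots> \<longleftrightarrow> graph_avoids_213 Q"
      using Q by (intro graph_avoids_213_insert_min) fastforce+
    also have "\<dots> \<longleftrightarrow> graph_avoids_213 (cycle_graph ?c')"
      unfolding g1 using Q by (intro graph_avoids_213_insert_min[symmetric]) fastforce+
    finally show ?thesis using av by simp
  qed
  then show ?thesis unfolding avoiding_cycles_def using sets by auto
qed

section \<open>Decomposition and the Fibonacci recurrence\<close>

text \<open>For \<open>Suc a < b\<close> these are all avoiders but the increasing one; for
  \<open>b = Suc a\<close> the increasing one is among them.\<close>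

definition avoiding_cycles_top :: "nat \<Rightarrow> nat \<Rightarrow> nat list set" where
  "avoiding_cycles_top a b = {c \<in> avoiding_cycles a b. \<exists>r. c = a # b # r}"

lemma finite_avoiding_cycles: "finite (avoiding_cycles a b)"
  by (rule finite_subset[OF _ finite_subset_distinct[of "{a..b}"]])
     (auto simp: avoiding_cycles_def)

lemma length_avoiding_cycle: "c \<in> avoiding_cycles a b \<Longrightarrow> length c = Suc b - a"
  using distinct_card[of c] by (auto simp: avoiding_cycles_def simp del: distinct_card)

lemma avoiding_cyclesE:
  assumes "c \<in> avoiding_cycles a b" "a < b"
  obtains j r where "c = a # j # r"
proof -
  have "length c = Suc (Suc (b - a - 1))" using length_avoiding_cycle[OF assms(1)] assms(2) by simp
  then obtain x j r where c: "c = x # j # r" unfolding length_Suc_conv by blast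
  have "hd c = a" using assms(1) by (simp add: avoiding_cycles_def)
  then show ?thesis using that c by simp
qed

lemma avoiding_cycles_self: "avoiding_cycles a a = {[a]}"
proof
  show "avoiding_cycles a a \<subseteq> {[a]}"
  proof
    fix c assume c: "c \<in> avoiding_cycles a a"
    then have "length c = Suc 0" by (simp add: length_avoiding_cycle)
    then obtain x where "c = [x]" by (auto simp: length_Suc_conv)
    then show "c \<in> {[a]}" using c by (simp add: avoiding_cycles_def)
  qed
  show "{[a]} \<subseteq> avoiding_cycles a a" using upt_avoiding[of a a] by simp
qed

lemma avoiding_cycles_insert:
  assumes "a < b"
  shows "avoiding_cycles a b = insert [a..<Suc b] (avoiding_cycles_top a b)"
proof
  show "avoiding_cycles a b \<subseteq> insert [a..<Suc b] (avoiding_cycles_top a b)"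
  proof
    fix c assume c: "c \<in> avoiding_cycles a b"
    then obtain j r where "c = a # j # r" using assms by (rule avoiding_cyclesE)
    then show "c \<in> insert [a..<Suc b] (avoiding_cycles_top a b)"
      using c second_entry increasing_cycle unfolding avoiding_cycles_top_def by blast
  qed
  show "insert [a..<Suc b] (avoiding_cycles_top a b) \<subseteq> avoiding_cycles a b"
    using upt_avoiding[of a b] assms by (auto simp: avoiding_cycles_top_def simp del: upt_Suc)
qed

lemma avoiding_cycles_top_Suc: "avoiding_cycles_top a (Suc a) = {[a, Suc a]}"
proof
  have "[a..<Suc (Suc a)] = [a, Suc a]" by simp
  then show "{[a, Suc a]} \<subseteq> avoiding_cycles_top a (Suc a)"
    using upt_avoiding[of a "Suc a"] by (simp add: avoiding_cycles_top_def)
  show "avoiding_cycles_top a (Suc a) \<subseteq> {[a, Suc a]}"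
    using increasing_cycle by (fastforce simp: avoiding_cycles_top_def)
qed

lemma avoiding_cycles_Suc: "avoiding_cycles a (Suc a) = {[a, Suc a]}"
  by (subst avoiding_cycles_insert) (auto simp: avoiding_cycles_top_Suc)

lemma card_avoiding_cycles_top:
  assumes "Suc a < b"
  shows "card (avoiding_cycles a b) = Suc (card (avoiding_cycles_top a b))"
proof -
  \<comment> \<open>The entry at index 1 separates the increasing cycle from the others, as
    \<open>Suc a < b\<close>.\<close>
  have "[a..<Suc b] ! 1 = Suc a"
    using assms by (simp add: nth_upt del: upt_Suc)
  moreover have "c ! 1 = b" if "c \<in> avoiding_cycles_top a b" for c
    using that by (auto simp: avoiding_cycles_top_def)
  ultimately have "[a..<Suc b] \<notin> avoiding_cycles_top a b"
    using assms by (metis less_irrefl)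
  moreover have "finite (avoiding_cycles_top a b)"
    using finite_avoiding_cycles unfolding avoiding_cycles_top_def by simp
  ultimately show ?thesis using assms by (simp add: avoiding_cycles_insert del: upt_Suc)
qed

text \<open>By \<open>third_entry\<close>, \<open>Suc a\<close> is third or last. In the latter case
  \<open>rotate1\<close> carries the leading \<open>Suc a\<close> of the smaller cycle to the
  end.\<close>

lemma avoiding_cycles_top_split:
  assumes "Suc a < b"
  shows "avoiding_cycles_top a b =
    (\<lambda>c. a # rotate1 c) ` avoiding_cycles_top (Suc a) b \<union>
    (\<lambda>c. a # b # c) ` avoiding_cycles (Suc a) (b - 1)" (is "_ = ?F \<union> ?G")
proof (intro equalityI subsetI)
  fix c assume "c \<in> avoiding_cycles_top a b"
  then obtain r where c: "c = a # b # r" "c \<in> avoiding_cycles a b"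
    by (auto simp: avoiding_cycles_top_def)
  have "set c = {a..b}" using c(2) by (simp add: avoiding_cycles_def)
  then have "Suc a \<in> set c" using assms by simp
  then obtain k r' where r: "r = k # r'" using c(1) assms by (cases r) auto
  show "c \<in> ?F \<union> ?G"
  proof (cases "k = Suc a")
    case True
    then have "Suc a # r' \<in> avoiding_cycles (Suc a) (b - 1)"
      using c r avoiding_cycles_Cons2_iff[OF assms] by simp
    then show ?thesis using c(1) r True by blast
  next
    case False
    then have "last r = Suc a" using third_entry c r by simp
    then have cr: "c = a # b # butlast r @ [Suc a]"
      using c(1) r append_butlast_last_id[of r] by simp
    then have "Suc a # b # butlast r \<in> avoiding_cycles_top (Suc a) b"
      using c(2) avoiding_cycles_rotate_iff[OF assms] by (simp add: avoiding_cycles_top_def)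
    then have "a # rotate1 (Suc a # b # butlast r) \<in> ?F" by (rule imageI)
    then show ?thesis using cr by simp
  qed
next
  fix c assume "c \<in> ?F \<union> ?G"
  then show "c \<in> avoiding_cycles_top a b"
  proof
    assume "c \<in> ?F"
    then show ?thesis
      using avoiding_cycles_rotate_iff[OF assms] by (auto simp: avoiding_cycles_top_def)
  next
    assume "c \<in> ?G"
    then obtain c' where c': "c = a # b # c'" "c' \<in> avoiding_cycles (Suc a) (b - 1)" by blast
    then have "set c' = {Suc a..b - 1}" "hd c' = Suc a" by (auto simp: avoiding_cycles_def)
    then obtain r where "c' = Suc a # r" using assms by (cases c') auto
    then show ?thesis
      using c' avoiding_cycles_Cons2_iff[OF assms] by (simp add: avoiding_cycles_top_def)
  qed
qed

lemma card_avoiding_cycles_top_rec: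
  assumes "Suc (Suc a) < b"
  shows "card (avoiding_cycles_top a b) =
    card (avoiding_cycles_top (Suc a) b) + card (avoiding_cycles (Suc a) (b - 1))"
proof -
  let ?f = "\<lambda>c. a # rotate1 c" and ?g = "\<lambda>c. a # b # c"
  have "inj ?f" "inj ?g" by (simp_all add: inj_def inj_eq[OF inj_rotate1])
  then have "card (?f ` avoiding_cycles_top (Suc a) b) = card (avoiding_cycles_top (Suc a) b)"
    "card (?g ` avoiding_cycles (Suc a) (b - 1)) = card (avoiding_cycles (Suc a) (b - 1))"
    by (auto intro: card_image inj_on_subset)
  moreover have "?f ` avoiding_cycles_top (Suc a) b \<inter> ?g ` avoiding_cycles (Suc a) (b - 1) = {}"
  proof (rule ccontr)
    assume "\<not> ?thesis"
    then obtain c c' where c: "c \<in> avoiding_cycles_top (Suc a) b"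
      "c' \<in> avoiding_cycles (Suc a) (b - 1)" "?f c = ?g c'" by blast
    then obtain r where r: "c = Suc a # b # r" by (auto simp: avoiding_cycles_top_def)
    then have c': "c' = r @ [Suc a]" using c(3) by simp
    \<comment> \<open>\<open>c'\<close> begins and ends with \<open>Suc a\<close>, so it has one
      entry by distinctness. Then \<open>{Suc a..b}\<close> would have only two elements.\<close>
    have "r = []"
      using c(2) unfolding c' by (cases r) (auto simp: avoiding_cycles_def)
    then have "{Suc a, b} = {Suc a..b}" using c(1) r by (auto simp: avoiding_cycles_top_def avoiding_cycles_def)
    moreover have "Suc (Suc a) \<in> {Suc a..b}" "Suc (Suc a) \<notin> {Suc a, b}" using assms by auto
    ultimately show False by blast
  qed
  moreover have "finite (avoiding_cycles_top (Suc a) b)"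
    using finite_avoiding_cycles unfolding avoiding_cycles_top_def by simp
  ultimately show ?thesis
    using assms by (simp add: avoiding_cycles_top_split card_Un_disjoint finite_avoiding_cycles)
qed

text \<open>For \<open>m > 2\<close>, write A for all avoiders, T for those with second entry
  \<open>b\<close>. Then A(a,b) = 1 + T(a,b) = 1 + T(a+1,b) + A(a+1,b-1) = A(a+1,b) + A(a+1,b-1).
  The left endpoint moves, so \<open>a\<close> is arbitrary in the induction.\<close>

lemma card_avoiding_cycles: "card (avoiding_cycles a (a + m)) = fib (Suc m)"
proof (induction m arbitrary: a rule: less_induct)
  case (less m)
  consider "m = 0" | "m = 1" | "m = 2" | "2 < m" by linarith
  then show ?case
  proof cases
    case 1
    then show ?thesis by (simp add: avoiding_cycles_self)
  next
    case 2
    then show ?thesis by (simp add: avoiding_cycles_Suc)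
  next
    case 3
    \<comment> \<open>On three elements the two images of the split coincide, so their cardinalities
      do not add.\<close>
    have "avoiding_cycles_top a (Suc (Suc a)) = {[a, Suc (Suc a), Suc a]}"
      by (subst avoiding_cycles_top_split) (simp_all add: avoiding_cycles_top_Suc avoiding_cycles_self)
    then show ?thesis
      using 3 card_avoiding_cycles_top[of a "Suc (Suc a)"] by (simp add: numeral_2_eq_2)
  next
    case 4
    define k where "k = m - 2"
    have m: "m = Suc (Suc k)" "0 < k" using 4 by (auto simp: k_def)
    have e: "a + m = Suc a + Suc k" "a + m - 1 = Suc a + k" using m by auto
    have "card (avoiding_cycles a (a + m)) =
        Suc (card (avoiding_cycles_top (Suc a) (a + m)) + card (avoiding_cycles (Suc a) (a + m - 1)))"
      using m by (subst card_avoiding_cycles_top, simp, subst card_avoiding_cycles_top_rec) simp_all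
    also have "\<dots> = card (avoiding_cycles (Suc a) (a + m)) + card (avoiding_cycles (Suc a) (a + m - 1))"
      using m by (subst card_avoiding_cycles_top[of "Suc a"]) simp_all
    also have "\<dots> = fib (Suc (Suc k)) + fib (Suc k)"
      unfolding e using less.IH[of "Suc k" "Suc a"] less.IH[of k "Suc a"] m by simp
    finally show ?thesis using m by simp
  qed
qed

section \<open>Translation from list patterns\<close>

lemma avoids_213_nth:
  "avoids_213 w \<longleftrightarrow>
     (\<forall>i j k. i < j \<longrightarrow> j < k \<longrightarrow> k < length w \<longrightarrow> w ! j < w ! i \<longrightarrow> \<not> w ! i < w ! k)"
  (is "_ \<longleftrightarrow> ?R w")
proof (induction w)
  case (Cons x xs)
  have "?R (x # xs) \<longleftrightarrow> sorted_wrt (\<lambda>u v. \<not> (u < x \<and> x < v)) xs \<and> ?R xs"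
  proof (intro iffI conjI)
    assume R: "?R (x # xs)"
    show "sorted_wrt (\<lambda>u v. \<not> (u < x \<and> x < v)) xs"
      unfolding sorted_wrt_iff_nth_less
    proof (intro allI impI)
      fix i j assume "i < j" "j < length xs"
      then show "\<not> (xs ! i < x \<and> x < xs ! j)"
        using R[rule_format, of 0 "Suc i" "Suc j"] by auto
    qed
    show "?R xs"
    proof (intro allI impI)
      fix i j k assume "i < j" "j < k" "k < length xs" "xs ! j < xs ! i"
      then show "\<not> xs ! i < xs ! k"
        using R[rule_format, of "Suc i" "Suc j" "Suc k"] by auto
    qed
  next
    assume R: "sorted_wrt (\<lambda>u v. \<not> (u < x \<and> x < v)) xs \<and> ?R xs"
    show "?R (x # xs)"
    proof (intro allI impI)
      fix i j k assume ijk: "i < j" "j < k" "k < length (x # xs)" "(x # xs) ! j < (x # xs) ! i"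
      then obtain j' k' where jk: "j = Suc j'" "k = Suc k'" by (metis less_nat_zero_code not0_implies_Suc)
      show "\<not> (x # xs) ! i < (x # xs) ! k"
      proof (cases i)
        case 0
        then show ?thesis
          using R ijk unfolding jk by (auto simp: sorted_wrt_iff_nth_less)
      next
        case (Suc i')
        then show ?thesis using R ijk unfolding jk by auto
      qed
    qed
  qed
  then show ?case using Cons by simp
qed simp

lemma avoids_iff_nth:
  "avoids w [2, 1, 3] \<longleftrightarrow>
     (\<forall>i j k. i < j \<longrightarrow> j < k \<longrightarrow> k < length w \<longrightarrow> w ! j < w ! i \<longrightarrow> \<not> w ! i < w ! k)"
proof -
  have "contains_pattern w [2, 1, 3] \<longleftrightarrow>
    (\<exists>i j k. i < j \<and> j < k \<and> k < length w \<and> w ! j < w ! i \<and> w ! i < w ! k)"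
  proof
    assume "contains_pattern w [2, 1, 3]"
    then obtain f where f: "strict_mono_on {..<3} f" "\<forall>a<3. f a < length w"
      "\<forall>a<3. \<forall>b<3. w ! f a < w ! f b \<longleftrightarrow> [2, 1, 3::nat] ! a < [2, 1, 3] ! b"
      unfolding contains_pattern_def by (auto simp: numeral_3_eq_3)
    have "f 0 < f 1" "f 1 < f 2" by (rule strict_mono_onD[OF f(1)]; simp)+
    moreover have "w ! f 1 < w ! f 0" "w ! f 0 < w ! f 2" "f 2 < length w"
      using f(2,3) by (auto simp: numeral_2_eq_2)
    ultimately show "\<exists>i j k. i < j \<and> j < k \<and> k < length w \<and> w ! j < w ! i \<and> w ! i < w ! k"
      by blast
  next
    assume "\<exists>i j k. i < j \<and> j < k \<and> k < length w \<and> w ! j < w ! i \<and> w ! i < w ! k"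
    then obtain i j k where ijk: "i < j" "j < k" "k < length w" "w ! j < w ! i" "w ! i < w ! k"
      by blast
    define f where "f = (\<lambda>x. [i, j, k] ! x)"
    have f: "f 0 = i" "f (Suc 0) = j" "f (Suc (Suc 0)) = k" by (auto simp: f_def)
    show "contains_pattern w [2, 1, 3]"
      unfolding contains_pattern_def
    proof (intro exI[of _ f] conjI)
      show "strict_mono_on {..<length [2, 1, 3::nat]} f"
        using ijk by (auto simp: strict_mono_on_def less_Suc_eq f)
    qed (use ijk in \<open>auto simp: less_Suc_eq f\<close>)
  qed
  then show ?thesis unfolding avoids_def by blast
qed

lemma avoids_iff_avoids_213: "avoids w [2, 1, 3] \<longleftrightarrow> avoids_213 w"
  unfolding avoids_iff_nth avoids_213_nth ..

lemma avoids_one_line_iff: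
  "avoids (one_line n \<pi>) [2, 1, 3] \<longleftrightarrow> graph_avoids_213 ((\<lambda>x. (x, \<pi> x)) ` {1..n})" (is "?L \<longleftrightarrow> ?R")
proof -
  \<comment> \<open>List indices start at 0, positions of \<open>\<pi>\<close> at 1.\<close>
  have nth: "one_line n \<pi> ! i = \<pi> (Suc i)" if "i < n" for i
    using that by (simp add: one_line_def del: upt_Suc)
  have len: "length (one_line n \<pi>) = n" by (simp add: one_line_def)
  show ?thesis
  proof
    assume L: ?L
    show ?R
      unfolding graph_avoids_213_def
    proof (clarsimp simp del: atLeastAtMost_iff)
      fix x y z assume "x \<in> {Suc 0..n}" "y \<in> {Suc 0..n}" "z \<in> {Suc 0..n}"
        and *: "x < y" "y < z" "\<pi> y < \<pi> x" "\<pi> x < \<pi> z"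
      then have "x - 1 < y - 1" "y - 1 < z - 1" "z - 1 < n"
        "Suc (x - 1) = x" "Suc (y - 1) = y" "Suc (z - 1) = z" by auto
      then show False
        using L[unfolded avoids_iff_nth, rule_format, of "x - 1" "y - 1" "z - 1"] * len
        by (simp add: nth)
    qed
  next
    assume R: ?R
    show ?L unfolding avoids_iff_nth len
    proof (intro allI impI notI)
      fix i j k assume "i < j" "j < k" "k < n" "one_line n \<pi> ! j < one_line n \<pi> ! i"
        "one_line n \<pi> ! i < one_line n \<pi> ! k"
      then show False
        using graph_avoids_213D[OF R, of "Suc i" "\<pi> (Suc i)" "Suc j" "\<pi> (Suc j)" "Suc k" "\<pi> (Suc k)"]
        by (auto simp: nth)
    qed
  qed
qed

section \<open>Cyclic permutations and their cycle notation\<close>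

lemma cycle_graph_eq_graph:
  assumes "map \<pi> c = rotate1 c"
  shows "cycle_graph c = (\<lambda>x. (x, \<pi> x)) ` set c"
  unfolding cycle_graph_def assms[symmetric] by (auto simp: zip_map2 zip_same_conv_map)

text \<open>The orbit of 1 is the whole interval, so its first return time \<open>?d\<close> is
  \<open>n\<close>. The iterates before the return are distinct and exhaust the orbit, and the
  return itself closes the rotation.\<close>

lemma cycle_notation_cyclic:
  assumes "cyclic_on \<pi> {1..n}" "n \<ge> 1"
  shows "distinct (cycle_notation n \<pi>)" "set (cycle_notation n \<pi>) = {1..n}"
    "map \<pi> (cycle_notation n \<pi>) = rotate1 (cycle_notation n \<pi>)"
proof -
  have o: "orbit \<pi> 1 = {1..n}" using assms by (intro orbit_cyclic_eq3) auto
  then have self: "1 \<in> orbit \<pi> 1" using assms(2) by simp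
  let ?d = "funpow_dist1 \<pi> 1 1"
  note inj = inj_on_funpow_dist1[OF self]
  have "card {1..n} = ?d"
    unfolding o[symmetric] orbit_conv_funpow_dist1[OF self] card_image[OF inj] by simp
  then have d: "?d = n" by simp
  show "distinct (cycle_notation n \<pi>)"
    using inj unfolding d cycle_notation_def distinct_map by simp
  show "set (cycle_notation n \<pi>) = {1..n}"
    unfolding o[symmetric] orbit_conv_funpow_dist1[OF self] d cycle_notation_def by simp
  have n1: "(\<pi> ^^ n) 1 = 1" using funpow_dist1_prop[OF self] unfolding d .
  show "map \<pi> (cycle_notation n \<pi>) = rotate1 (cycle_notation n \<pi>)"
  proof (rule nth_equalityI)
    fix i assume "i < length (map \<pi> (cycle_notation n \<pi>))"
    then have i: "i < n" by (simp add: cycle_notation_def)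
    show "map \<pi> (cycle_notation n \<pi>) ! i = rotate1 (cycle_notation n \<pi>) ! i"
    proof (cases "Suc i = n")
      case True
      then show ?thesis using i n1 by (auto simp: cycle_notation_def nth_rotate1)
    next
      case False
      then show ?thesis using i by (simp add: cycle_notation_def nth_rotate1)
    qed
  qed simp
qed

text \<open>Mapping the \<open>i\<close>-th power of the cycle over \<open>c\<close> rotates
  \<open>c\<close> by \<open>i\<close>; the head of the result is \<open>c ! i\<close>.\<close>

lemma cycle_notation_cycle_of_list:
  assumes "distinct c" "hd c = 1" "length c = n" "c \<noteq> []"
  shows "cycle_notation n (cycle_of_list c) = c"
proof (rule nth_equalityI)
  fix i assume "i < length (cycle_notation n (cycle_of_list c))"
  then have i: "i < n" by (simp add: cycle_notation_def)
  have "(cycle_of_list c ^^ i) 1 = map (cycle_of_list c ^^ i) c ! 0"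
    unfolding assms(2)[symmetric] using assms(4) by (simp add: hd_conv_nth)
  also have "\<dots> = c ! i"
    using i assms by (simp add: cyclic_rotation nth_rotate)
  finally show "cycle_notation n (cycle_of_list c) ! i = c ! i"
    using i by (simp add: cycle_notation_def)
qed (use assms in \<open>simp add: cycle_notation_def\<close>)

lemma cyclic_on_cycle_of_list:
  assumes "distinct c" "c \<noteq> []"
  shows "cyclic_on (cycle_of_list c) (set c)"
proof (rule cyclic_on_singleI[of "hd c"])
  let ?f = "cycle_of_list c"
  have nth: "(?f ^^ i) (hd c) = c ! (i mod length c)" for i
  proof -
    have "(?f ^^ i) (hd c) = map (?f ^^ i) c ! 0"
      using assms by (simp add: hd_conv_nth)
    then show ?thesis using assms by (simp add: cyclic_rotation nth_rotate)
  qed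
  show "set c = orbit ?f (hd c)"
  proof
    show "set c \<subseteq> orbit ?f (hd c)"
    proof
      fix x assume "x \<in> set c"
      then obtain i where "i < length c" "c ! i = x" by (auto simp: in_set_conv_nth)
      \<comment> \<open>An orbit consists of positive iterates; the extra full turn covers
        \<open>i = 0\<close>.\<close>
      then have "(?f ^^ (i + length c)) (hd c) = x" "0 < i + length c"
        using assms(2) by (simp_all add: nth)
      then show "x \<in> orbit ?f (hd c)" unfolding orbit_altdef by blast
    qed
    show "orbit ?f (hd c) \<subseteq> set c"
      using assms by (auto simp: orbit_altdef nth)
  qed
qed (use assms in simp)

lemma bij_betw_cycle_notation:
  assumes "n \<ge> 1"
  shows "bij_betw (cycle_notation n) (cyclic_avoiders n [2, 1, 3] [2, 1, 3]) (avoiding_cycles 1 n)"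
proof (rule bij_betw_imageI)
  show "inj_on (cycle_notation n) (cyclic_avoiders n [2, 1, 3] [2, 1, 3])"
  proof (rule inj_onI)
    fix \<pi> \<rho> assume p: "\<pi> \<in> cyclic_avoiders n [2, 1, 3] [2, 1, 3]" and
      r: "\<rho> \<in> cyclic_avoiders n [2, 1, 3] [2, 1, 3]" and
      eq: "cycle_notation n \<pi> = cycle_notation n \<rho>"
    have pi: "\<pi> permutes {1..n}" "cyclic_on \<pi> {1..n}" and rho: "\<rho> permutes {1..n}" "cyclic_on \<rho> {1..n}"
      using p r by (auto simp: cyclic_avoiders_def)
    \<comment> \<open>The rotated cycle notation lists the images, so equal notations force equal
      values on \<open>{1..n}\<close>; outside, both are the identity.\<close>
    have "map \<pi> (cycle_notation n \<pi>) = map \<rho> (cycle_notation n \<pi>)"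
      using cycle_notation_cyclic(3)[OF pi(2) assms] cycle_notation_cyclic(3)[OF rho(2) assms] eq by simp
    then have "\<forall>x \<in> {1..n}. \<pi> x = \<rho> x"
      using cycle_notation_cyclic(2)[OF pi(2) assms] by (metis map_eq_conv)
    then show "\<pi> = \<rho>" using pi(1) rho(1) by (metis ext permutes_not_in)
  qed
  have iff: "\<pi> \<in> cyclic_avoiders n [2, 1, 3] [2, 1, 3] \<longleftrightarrow> cycle_notation n \<pi> \<in> avoiding_cycles 1 n"
    if "\<pi> permutes {1..n}" "cyclic_on \<pi> {1..n}" for \<pi>
  proof -
    note c = cycle_notation_cyclic[OF that(2) assms]
    have "hd (cycle_notation n \<pi>) = 1" using assms by (simp add: cycle_notation_def hd_map)
    moreover have "avoids (one_line n \<pi>) [2, 1, 3] \<longleftrightarrow>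
        graph_avoids_213 (cycle_graph (cycle_notation n \<pi>))"
      unfolding avoids_one_line_iff cycle_graph_eq_graph[OF c(3)] c(2) ..
    ultimately show ?thesis
      using that c(1,2) avoids_iff_avoids_213[of "cycle_notation n \<pi>"]
      unfolding cyclic_avoiders_def avoiding_cycles_def by auto
  qed
  show "cycle_notation n ` cyclic_avoiders n [2, 1, 3] [2, 1, 3] = avoiding_cycles 1 n"
  proof (intro equalityI subsetI)
    fix c assume "c \<in> cycle_notation n ` cyclic_avoiders n [2, 1, 3] [2, 1, 3]"
    then show "c \<in> avoiding_cycles 1 n" using iff by (auto simp: cyclic_avoiders_def)
  next
    fix c assume c: "c \<in> avoiding_cycles 1 n"
    then have d: "distinct c" "set c = {1..n}" "hd c = 1" by (auto simp: avoiding_cycles_def)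
    have ne: "c \<noteq> []" using d(2) assms by auto
    have len: "length c = n" using distinct_card[OF d(1)] d(2) by simp
    \<comment> \<open>The preimage of \<open>c\<close> is the cycle that \<open>c\<close> itself
      describes.\<close>
    let ?f = "cycle_of_list c"
    have "?f permutes {1..n}" "cyclic_on ?f {1..n}"
      using cycle_permutes[of c] cyclic_on_cycle_of_list[OF d(1) ne] d(2) by auto
    moreover have "cycle_notation n ?f = c"
      using cycle_notation_cycle_of_list[OF d(1,3) len ne] .
    ultimately show "c \<in> cycle_notation n ` cyclic_avoiders n [2, 1, 3] [2, 1, 3]"
      using iff c by (metis imageI)
  qed
qed

theorem theorem3p13:
  fixes n :: nat
  assumes "n \<ge> 1"
  shows "num_cyclic_avoiders n [2, 1, 3] [2, 1, 3] = fib n"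
  using bij_betw_same_card[OF bij_betw_cycle_notation[OF assms]] card_avoiding_cycles[of 1 "n - 1"] assms
  by (simp add: num_cyclic_avoiders_def)

end
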